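(* For all positive integers $n$ and $s$, $$\sum_{\substack{a=1\\ (a,n^s)_s=1}}^{n^s} (a-1,n^s)_s=\Phi_s(n^s)\,\tau_s(n^s).$$
   Context: For a positive integer $s$ and integers $a,b$ not both zero, $(a,b)_s$ (the generalized gcd) denotes the largest $l^s$ with $l\in\mathbb{N}$ such that $l^s$ divides both $a$ and $b$; in particular $(0,b)_s$ is the largest $s$-th power dividing $b$. For positive integers $s,m$, Klee's function $\Phi_s(m)$ is the number of integers $k$ with $1\le k\le m$ and $(k,m)_s=1$. For a positive integer $m$, $\tau_s(m)$ denotes the number of positive integers $d$ such that $d^s$ divides $m$. *)

theory Defs
  imports Complex_Main
begin

text \<open>Meaningful for \<open>s > 0\<close> and \<open>a\<close>, \<open>b\<close> not both zero; the set is then finite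
  and contains \<open>1\<close>, as shown below.\<close>

definition gen_gcd :: "nat \<Rightarrow> int \<Rightarrow> int \<Rightarrow> nat" where
  "gen_gcd s a b = Max {l ^ s | l :: nat. l > 0 \<and> int (l ^ s) dvd a \<and> int (l ^ s) dvd b}"

definition klee_phi :: "nat \<Rightarrow> nat \<Rightarrow> nat" where
  "klee_phi s m = card {k :: nat. 1 \<le> k \<and> k \<le> m \<and> gen_gcd s (int k) (int m) = 1}"

definition tau_s :: "nat \<Rightarrow> nat \<Rightarrow> nat" where
  "tau_s s m = card {d :: nat. d > 0 \<and> d ^ s dvd m}"

lemma gen_gcd_set_finite:
  assumes "a \<noteq> 0 \<or> b \<noteq> 0"
  shows "finite {l ^ s | l :: nat. l > 0 \<and> int (l ^ s) dvd a \<and> int (l ^ s) dvd b}"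
proof (rule finite_subset)
  show "{l ^ s | l :: nat. l > 0 \<and> int (l ^ s) dvd a \<and> int (l ^ s) dvd b}
    \<subseteq> {..nat (\<bar>a\<bar> + \<bar>b\<bar>)}"
  proof
    fix x assume "x \<in> {l ^ s | l :: nat. l > 0 \<and> int (l ^ s) dvd a \<and> int (l ^ s) dvd b}"
    then have "int x dvd a" "int x dvd b" by auto
    then have "int x \<le> \<bar>a\<bar> + \<bar>b\<bar>"
      using assms dvd_imp_le_int[of a "int x"] dvd_imp_le_int[of b "int x"] by fastforce
    then show "x \<in> {..nat (\<bar>a\<bar> + \<bar>b\<bar>)}" by simp
  qed
qed simp

lemma gen_gcd_set_one:
  "1 \<in> {l ^ s | l :: nat. l > 0 \<and> int (l ^ s) dvd a \<and> int (l ^ s) dvd b}"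
  by (auto intro!: exI[of _ 1])

end

theory Submission
  imports Defs "HOL-Number_Theory.Cong"
begin

text \<open>For \<open>g dvd n\<close> one has \<open>g ^ s = (\<Sum>d | d dvd g. klee_phi s (d ^ s))\<close>, so
  expanding \<open>(a - 1, n ^ s)\<^sub>s\<close> and exchanging sums reduces the claim to counting, for each
  \<open>d dvd n\<close>, the admissible \<open>a\<close> with \<open>a = 1\<close> modulo \<open>d ^ s\<close>. Admissible residues do not
  form a group when \<open>s > 1\<close>, but reduction modulo \<open>d ^ s\<close> still has fibres of equal size over
  the admissible residues modulo \<open>d ^ s\<close>: two fibres are exchanged by a translation that is
  divisible by \<open>p ^ s\<close> for every prime \<open>p\<close> dividing \<open>n\<close> but not \<open>d\<close>. Each
  \<open>d\<close> therefore contributes exactly \<open>klee_phi s (n ^ s)\<close>.\<close>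

section \<open>Divisibility properties of the generalized gcd\<close>

text \<open>The admissible bases \<open>l\<close> are closed under \<open>lcm\<close>, so the
  largest one is also a multiple of all the others. This gives the root \<open>g\<close> the
  universal property of a gcd, and later arguments use it in place of \<open>Max\<close>.\<close>

lemma gen_gcd_powerE:
  fixes n s :: nat and a :: int
  assumes "n > 0" "s > 0"
  obtains g where "g > 0" "gen_gcd s a (int (n ^ s)) = g ^ s"
    "\<And>l. l dvd g \<longleftrightarrow> l dvd n \<and> int (l ^ s) dvd a"
proof -
  define A where "A = {l. l dvd n \<and> int (l ^ s) dvd a}"
  have fin: "finite A" unfolding A_def using assms by simp
  have "1 \<in> A" unfolding A_def by simp
  define g where "g = Max A"
  have gA: "g \<in> A" unfolding g_def using fin \<open>1 \<in> A\<close> by (intro Max_in) auto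
  hence gpos: "g > 0" using assms unfolding A_def by (auto intro: Nat.gr0I)
  have dvd_g: "l dvd g" if l: "l \<in> A" for l
  proof -
    have "l ^ s dvd nat \<bar>a\<bar>" "g ^ s dvd nat \<bar>a\<bar>"
      using l gA unfolding A_def by (auto simp only: mem_Collect_eq dvd_nat_abs_iff)
    hence "lcm (l ^ s) (g ^ s) dvd nat \<bar>a\<bar>" by (rule lcm_least)
    \<comment> \<open>Both sides times \<open>gcd l g ^ s\<close> equal
      \<open>l ^ s * g ^ s\<close>, as \<open>gcd\<close> commutes with powers; cancel that
      factor.\<close>
    moreover have "lcm l g ^ s dvd lcm (l ^ s) (g ^ s)"
    proof -
      have "lcm l g ^ s * gcd l g ^ s = lcm (l ^ s) (g ^ s) * gcd (l ^ s) (g ^ s)"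
        by (metis power_mult_distrib prod_gcd_lcm_nat mult.commute)
      thus ?thesis using gpos by (simp add: gcd_exp)
    qed
    ultimately have "lcm l g ^ s dvd nat \<bar>a\<bar>" using dvd_trans by blast
    hence "int (lcm l g ^ s) dvd a" by (simp only: dvd_nat_abs_iff)
    hence "lcm l g \<in> A" using l gA unfolding A_def by auto
    hence "lcm l g \<le> g" unfolding g_def using fin by simp
    moreover have "lcm l g > 0"
      using \<open>lcm l g \<in> A\<close> assms(1) unfolding A_def by (intro Nat.gr0I) simp
    hence "g \<le> lcm l g" by (intro dvd_imp_le) auto
    ultimately have "lcm l g = g" by simp
    thus ?thesis by (metis dvd_lcm1)
  qed
  have iff: "l dvd g \<longleftrightarrow> l \<in> A" for l
  proof
    assume "l dvd g"
    moreover from this have "int (l ^ s) dvd int (g ^ s)"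
      by (simp only: int_dvd_int_iff dvd_power_same)
    moreover have "g dvd n" "int (g ^ s) dvd a" using gA unfolding A_def by simp_all
    ultimately have "l dvd n" "int (l ^ s) dvd a" by (blast intro: dvd_trans)+
    thus "l \<in> A" unfolding A_def by simp
  qed (rule dvd_g)
  have "gen_gcd s a (int (n ^ s)) = g ^ s"
    unfolding gen_gcd_def
  proof (rule Max_eqI)
    show "finite {l ^ s | l. l > 0 \<and> int (l ^ s) dvd a \<and> int (l ^ s) dvd int (n ^ s)}"
      using assms by (intro gen_gcd_set_finite) simp
  next
    fix y assume "y \<in> {l ^ s | l. l > 0 \<and> int (l ^ s) dvd a \<and> int (l ^ s) dvd int (n ^ s)}"
    then obtain l where l: "y = l ^ s" "int (l ^ s) dvd a" "l ^ s dvd n ^ s"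
      by (auto simp only: int_dvd_int_iff mem_Collect_eq)
    hence "l \<in> A" using assms unfolding A_def by simp
    hence "l \<le> g" unfolding g_def using fin by simp
    thus "y \<le> g ^ s" using l by (simp add: power_mono)
  next
    show "g ^ s \<in> {l ^ s | l. l > 0 \<and> int (l ^ s) dvd a \<and> int (l ^ s) dvd int (n ^ s)}"
      using gA gpos unfolding A_def by (auto simp only: int_dvd_int_iff dvd_power_same)
  qed
  thus thesis using that gpos iff unfolding A_def by blast
qed

text \<open>The root is 1 exactly when no prime divides it. Admissibility thus becomes a separate
  condition at each prime of \<open>n\<close>, which can be controlled by congruences.\<close>

lemma gen_gcd_eq_1_iff:
  fixes n s :: nat and a :: int
  assumes "n > 0" "s > 0"
  shows "gen_gcd s a (int (n ^ s)) = 1 \<longleftrightarrow> (\<forall>p. prime p \<and> p dvd n \<longrightarrow> \<not> int (p ^ s) dvd a)"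
proof -
  obtain g where g: "g > 0" "gen_gcd s a (int (n ^ s)) = g ^ s"
    "\<And>l. l dvd g \<longleftrightarrow> l dvd n \<and> int (l ^ s) dvd a"
    using gen_gcd_powerE[OF assms] by metis
  have "g ^ s = 1 \<longleftrightarrow> g = 1" using assms by simp
  also have "\<dots> \<longleftrightarrow> (\<forall>p. prime p \<longrightarrow> \<not> p dvd g)"
    by (metis prime_factor_nat not_prime_unit nat_dvd_1_iff_1)
  finally show ?thesis using g by auto
qed

lemma gen_gcd_scale:
  fixes d g s :: nat and k :: int
  assumes "d > 0" "g > 0" "s > 0"
  shows "gen_gcd s (int (g ^ s) * k) (int ((g * d) ^ s)) = g ^ s * gen_gcd s k (int (d ^ s))"
proof -
  obtain h where h: "h > 0" "gen_gcd s k (int (d ^ s)) = h ^ s"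
    "\<And>l. l dvd h \<longleftrightarrow> l dvd d \<and> int (l ^ s) dvd k"
    using gen_gcd_powerE[OF assms(1,3)] by metis
  obtain G where G: "G > 0" "gen_gcd s (int (g ^ s) * k) (int ((g * d) ^ s)) = G ^ s"
    "\<And>l. l dvd G \<longleftrightarrow> l dvd g * d \<and> int (l ^ s) dvd int (g ^ s) * k"
    using gen_gcd_powerE[of "g * d" s] assms by (metis nat_0_less_mult_iff)
  \<comment> \<open>The common factor \<open>g\<close> cancels in both conditions characterizing the
    divisors of \<open>G\<close>. Taking \<open>l = h\<close> and \<open>l = G / g\<close> then
    gives divisibility both ways.\<close>
  have iff: "g * l dvd G \<longleftrightarrow> l dvd h" for l
    using assms by (simp add: G(3) h(3) power_mult_distrib)
  hence "g * h dvd G" by simp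
  moreover have "g dvd G" using iff[of 1] by simp
  then obtain h' where "G = g * h'" by blast
  hence "G dvd g * h" using iff[of h'] by simp
  ultimately have "G = g * h" by (rule dvd_antisym[rotated])
  thus ?thesis using G h by (simp add: power_mult_distrib)
qed

lemma gen_gcd_cong:
  assumes "[a = b] (mod m)"
  shows "gen_gcd s a m = gen_gcd s b m"
proof -
  have "k dvd a \<and> k dvd m \<longleftrightarrow> k dvd b \<and> k dvd m" for k
    using assms by (meson cong_dvd_iff cong_dvd_modulus)
  thus ?thesis unfolding gen_gcd_def by simp
qed

section \<open>Admissible residues and the divisor sum of Klee's function\<close>

text \<open>The representatives start at 0, so that they are the values of \<open>mod\<close>; they
  are integers, so that differences are not truncated.\<close>

definition klee_residues :: "nat \<Rightarrow> nat \<Rightarrow> int set" where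
  "klee_residues s m = {a \<in> {0..<int m}. gen_gcd s a (int m) = 1}"

lemma finite_klee_residues [simp]: "finite (klee_residues s m)"
  unfolding klee_residues_def by (rule finite_Collect_conjI) simp

lemma sum_int_residues:
  fixes f :: "int \<Rightarrow> nat"
  assumes "f 0 = f (int m)"
  shows "(\<Sum>a\<in>{1..m}. f (int a)) = (\<Sum>a\<in>{0..<int m}. f a)"
proof -
  have "(\<Sum>a\<in>{1..m}. f (int a)) = (\<Sum>a\<in>{0..<m}. f (int a))"
  proof (cases m)
    case (Suc k)
    have "(\<Sum>a\<in>{1..m}. f (int a)) = (\<Sum>a\<in>{1..k}. f (int a)) + f (int m)"
      using Suc by simp
    also have "\<dots> = (\<Sum>a\<in>{0..<m}. f (int a))"
      unfolding Suc using assms Suc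
      by (simp add: sum.atLeast_Suc_atMost atLeastLessThanSuc_atLeastAtMost del: sum.op_ivl_Suc)
    finally show ?thesis .
  qed simp
  also have "\<dots> = (\<Sum>a\<in>int ` {0..<m}. f a)" by (simp add: sum.reindex)
  finally show ?thesis by (simp add: image_int_atLeastLessThan)
qed

lemma klee_phi_eq_card: "klee_phi s m = card (klee_residues s m)"
proof -
  let ?f = "\<lambda>a. if gen_gcd s a (int m) = 1 then 1 else 0 :: nat"
  have "klee_phi s m = (\<Sum>a\<in>{1..m}. ?f (int a))"
    unfolding klee_phi_def by (simp add: sum.If_cases Int_def)
  also have "\<dots> = (\<Sum>a\<in>{0..<int m}. ?f a)"
    using gen_gcd_cong[of 0 "int m" "int m" s] by (intro sum_int_residues) (simp add: cong_def)
  also have "\<dots> = card (klee_residues s m)"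
    unfolding klee_residues_def by (simp add: sum.If_cases Int_def)
  finally show ?thesis .
qed

text \<open>By \<open>gen_gcd_scale\<close>, multiplication by \<open>g ^ s\<close> is a bijection
  from the admissible residues modulo \<open>d ^ s\<close> onto this set.\<close>

lemma card_gen_gcd_eq:
  fixes d g s :: nat
  assumes "d > 0" "g > 0" "s > 0"
  shows "card {a \<in> {0..<int ((g * d) ^ s)}. gen_gcd s a (int ((g * d) ^ s)) = g ^ s} = klee_phi s (d ^ s)"
proof -
  have "{a \<in> {0..<int ((g * d) ^ s)}. gen_gcd s a (int ((g * d) ^ s)) = g ^ s}
      = (\<lambda>k. int (g ^ s) * k) ` klee_residues s (d ^ s)" (is "?A = ?f ` ?B")
  proof (intro equalityI subsetI)
    fix a assume a: "a \<in> ?A"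
    have "int (g ^ s) dvd a"
    proof -
      obtain G where "gen_gcd s a (int ((g * d) ^ s)) = G ^ s"
        "\<And>l. l dvd G \<longleftrightarrow> l dvd g * d \<and> int (l ^ s) dvd a"
        using gen_gcd_powerE[of "g * d" s] assms by (metis nat_0_less_mult_iff)
      thus ?thesis using a assms by (metis (mono_tags, lifting) mem_Collect_eq power_eq_iff_eq_base zero_le dvd_refl)
    qed
    then obtain k where k: "a = int (g ^ s) * k" by blast
    have gs: "int (g ^ s) > 0" using assms by simp
    have "0 \<le> k" "k < int (d ^ s)"
      using a gs unfolding k
      by (simp_all only: mem_Collect_eq atLeastLessThan_iff power_mult_distrib of_nat_mult
          zero_le_mult_iff mult_less_cancel_left_pos) linarith
    hence "k \<in> ?B"
      using a assms gen_gcd_scale[OF assms, of k] unfolding klee_residues_def k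
      by (auto simp: power_mult_distrib)
    thus "a \<in> ?f ` ?B" using k by blast
  next
    fix a assume "a \<in> ?f ` ?B"
    thus "a \<in> ?A"
      using assms gen_gcd_scale[OF assms] unfolding klee_residues_def
      by (auto simp: power_mult_distrib)
  qed
  moreover have "inj_on ?f ?B" using assms by (intro inj_onI) simp
  ultimately show ?thesis by (simp add: card_image klee_phi_eq_card)
qed

text \<open>The analogue of Gauss's identity for Euler's totient: sort all residues modulo
  \<open>n ^ s\<close> by their generalized gcd with \<open>n ^ s\<close>.\<close>

lemma sum_klee_phi_divisors:
  fixes n s :: nat
  assumes "n > 0" "s > 0"
  shows "(\<Sum>d | d dvd n. klee_phi s (d ^ s)) = n ^ s"
proof -
  let ?S = "\<lambda>g. {a \<in> {0..<int (n ^ s)}. gen_gcd s a (int (n ^ s)) = g ^ s}"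
  have "{0..<int (n ^ s)} = (\<Union>g\<in>{g. g dvd n}. ?S g)"
  proof (intro equalityI subsetI)
    fix a assume a: "a \<in> {0..<int (n ^ s)}"
    obtain g where g: "gen_gcd s a (int (n ^ s)) = g ^ s"
        "\<And>l. l dvd g \<longleftrightarrow> l dvd n \<and> int (l ^ s) dvd a"
      using gen_gcd_powerE[OF assms] by metis
    have "g dvd n" using g(2)[of g] by simp
    thus "a \<in> (\<Union>g\<in>{g. g dvd n}. ?S g)" using a g(1) by blast
  qed blast
  hence "n ^ s = card (\<Union>g\<in>{g. g dvd n}. ?S g)"
    by (metis card_atLeastLessThan_int diff_zero nat_int)
  also have "\<dots> = (\<Sum>g | g dvd n. card (?S g))"
  proof (rule card_UN_disjoint)
    show "\<forall>g\<in>{g. g dvd n}. finite (?S g)" by (intro ballI finite_Collect_conjI) simp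
    show "\<forall>g\<in>{g. g dvd n}. \<forall>h\<in>{g. g dvd n}. g \<noteq> h \<longrightarrow> ?S g \<inter> ?S h = {}"
      using assms by (auto simp: power_eq_iff_eq_base)
  qed (use assms in simp)
  also have "\<dots> = (\<Sum>g | g dvd n. klee_phi s ((n div g) ^ s))"
  proof (rule sum.cong)
    fix g assume "g \<in> {g. g dvd n}"
    then obtain d where d: "n = g * d" by auto
    with assms have "d > 0" "g > 0" by auto
    thus "card (?S g) = klee_phi s ((n div g) ^ s)"
      using card_gen_gcd_eq[of d g s] assms d by simp
  qed simp
  also have "\<dots> = (\<Sum>d | d dvd n. klee_phi s (d ^ s))"
    using assms by (intro sum.reindex_bij_witness[of _ "\<lambda>d. n div d" "\<lambda>d. n div d"]) auto
  finally show ?thesis ..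
qed

section \<open>Fibres of reduction modulo \<open>d ^ s\<close>\<close>

lemma mod_in_klee_residues:
  fixes d n s :: nat
  assumes "n > 0" "s > 0" "d dvd n" "gen_gcd s a (int (n ^ s)) = 1"
  shows "a mod int (d ^ s) \<in> klee_residues s (d ^ s)"
proof -
  have "d > 0" using assms by (auto intro: Nat.gr0I)
  hence "gen_gcd s a (int (d ^ s)) = 1"
    using assms gen_gcd_eq_1_iff[of n s a] gen_gcd_eq_1_iff[of d s a] dvd_trans by blast
  moreover have "gen_gcd s (a mod int (d ^ s)) (int (d ^ s)) = gen_gcd s a (int (d ^ s))"
    by (intro gen_gcd_cong) (simp add: cong_def)
  ultimately show ?thesis
    unfolding klee_residues_def using \<open>d > 0\<close> by simp
qed

text \<open>A translation modulo \<open>n ^ s\<close> injects one fibre into the other. The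
  hypotheses are symmetric in \<open>c\<close> and \<open>c'\<close>, so exchanging them yields
  equality.\<close>

lemma card_fibre_le:
  fixes d n s :: nat
  assumes n: "n > 0" and s: "s > 0" and d: "d dvd n"
    and c: "c \<in> klee_residues s (d ^ s)" "c' \<in> klee_residues s (d ^ s)"
  shows "card {a \<in> klee_residues s (n ^ s). a mod int (d ^ s) = c}
    \<le> card {a \<in> klee_residues s (n ^ s). a mod int (d ^ s) = c'}"
proof -
  have dpos: "d > 0" using n d by (auto intro: Nat.gr0I)
  let ?N = "int (n ^ s)" and ?D = "int (d ^ s)"
  have DN: "?D dvd ?N" using d by (simp only: int_dvd_int_iff dvd_power_same)
  have Npos: "?N > 0" using n by simp
  define P where "P = {p. prime p \<and> p dvd n \<and> \<not> p dvd d}"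
  have finP: "finite P" unfolding P_def using n by simp
  have "coprime d (\<Prod>P)"
    unfolding P_def by (intro prod_coprime_right) (auto intro: prime_imp_coprime simp: coprime_commute)
  hence "coprime ?D (int (\<Prod>P ^ s))"
    by (simp only: coprime_int_iff coprime_power_left_iff coprime_power_right_iff simp_thms)
  \<comment> \<open>The first congruence moves the fibre over \<open>c\<close> to the one over
    \<open>c'\<close>; the second preserves admissibility at the primes in \<open>P\<close>.\<close>
  then obtain t where t: "[t = c' - c] (mod ?D)" "[t = 0] (mod int (\<Prod>P ^ s))"
    using binary_chinese_remainder_int by blast
  let ?f = "\<lambda>a. (a + t) mod ?N"
  have "inj_on ?f {a \<in> klee_residues s (n ^ s). a mod ?D = c}"
  proof (rule inj_onI)
    fix a b assume ab: "a \<in> {a \<in> klee_residues s (n ^ s). a mod ?D = c}"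
      "b \<in> {a \<in> klee_residues s (n ^ s). a mod ?D = c}" and "?f a = ?f b"
    hence "[a = b] (mod ?N)" by (metis cong_add_rcancel cong_def)
    thus "a = b" using ab unfolding klee_residues_def cong_def by simp
  qed
  moreover have "?f a \<in> {a \<in> klee_residues s (n ^ s). a mod ?D = c'}"
    if a: "a \<in> klee_residues s (n ^ s)" "a mod ?D = c" for a
  proof -
    have "[a + t = c + (c' - c)] (mod ?D)"
      using a t c by (intro cong_add) (auto simp: cong_def)
    hence at: "[a + t = c'] (mod ?D)" by simp
    hence fD: "?f a mod ?D = c'"
      using DN c unfolding klee_residues_def cong_def by (simp add: mod_mod_cancel)
    \<comment> \<open>At primes dividing \<open>d\<close> the sum inherits admissibility from
      \<open>c'\<close>, at the remaining primes from \<open>a\<close>.\<close>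
    have "\<not> int (p ^ s) dvd a + t" if p: "prime p" "p dvd n" for p
    proof (cases "p dvd d")
      case True
      hence "int (p ^ s) dvd ?D" by (simp only: int_dvd_int_iff dvd_power_same)
      hence "[a + t = c'] (mod int (p ^ s))" using at cong_dvd_modulus by blast
      moreover have "\<not> int (p ^ s) dvd c'"
        using c(2) True p gen_gcd_eq_1_iff[OF dpos s] unfolding klee_residues_def by blast
      ultimately show ?thesis by (meson cong_dvd_iff dvd_refl)
    next
      case False
      hence "p dvd \<Prod>P" using p finP unfolding P_def by (intro dvd_prodI) auto
      hence "int (p ^ s) dvd int (\<Prod>P ^ s)" by (simp only: int_dvd_int_iff dvd_power_same)
      moreover have "int (\<Prod>P ^ s) dvd t" using t(2) by (simp only: cong_0_iff)
      ultimately have "int (p ^ s) dvd t" by (rule dvd_trans)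
      moreover have "\<not> int (p ^ s) dvd a"
        using a(1) p gen_gcd_eq_1_iff[OF n s] unfolding klee_residues_def by blast
      ultimately show ?thesis by (simp only: dvd_add_left_iff simp_thms)
    qed
    hence "gen_gcd s (a + t) ?N = 1" using gen_gcd_eq_1_iff[OF n s] by blast
    moreover have "gen_gcd s (?f a) ?N = gen_gcd s (a + t) ?N"
      by (intro gen_gcd_cong) (simp add: cong_def)
    ultimately show ?thesis using fD Npos unfolding klee_residues_def by simp
  qed
  ultimately show ?thesis by (intro card_inj_on_le[of ?f]) auto
qed

lemma klee_phi_mult_card_fibre:
  fixes d n s :: nat
  assumes "n > 0" "s > 0" "d dvd n" and c: "c \<in> klee_residues s (d ^ s)"
  shows "klee_phi s (d ^ s) * card {a \<in> klee_residues s (n ^ s). a mod int (d ^ s) = c}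
    = klee_phi s (n ^ s)"
proof -
  let ?F = "\<lambda>c. {a \<in> klee_residues s (n ^ s). a mod int (d ^ s) = c}"
  have "klee_residues s (n ^ s) = (\<Union>c\<in>klee_residues s (d ^ s). ?F c)"
    using mod_in_klee_residues[OF assms(1-3)] unfolding klee_residues_def[of s "n ^ s"] by blast
  hence "klee_phi s (n ^ s) = card (\<Union>c\<in>klee_residues s (d ^ s). ?F c)"
    by (simp add: klee_phi_eq_card)
  also have "\<dots> = (\<Sum>c'\<in>klee_residues s (d ^ s). card (?F c'))"
    by (intro card_UN_disjoint) auto
  also have "\<dots> = (\<Sum>c'\<in>klee_residues s (d ^ s). card (?F c))"
    using card_fibre_le[OF assms(1-3)] c by (intro sum.cong refl le_antisym) auto
  finally show ?thesis by (simp add: klee_phi_eq_card)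
qed

section \<open>Expansion of the gcd and exchange of sums\<close>

text \<open>The index set consists of the divisors of the root \<open>g\<close>, so this is the
  divisor sum for \<open>g ^ s\<close>.\<close>

lemma gen_gcd_eq_sum_klee_phi:
  fixes n s :: nat and a :: int
  assumes "n > 0" "s > 0"
  shows "gen_gcd s a (int (n ^ s)) = (\<Sum>d | d dvd n \<and> int (d ^ s) dvd a. klee_phi s (d ^ s))"
proof -
  obtain g where g: "g > 0" "gen_gcd s a (int (n ^ s)) = g ^ s"
    "\<And>l. l dvd g \<longleftrightarrow> l dvd n \<and> int (l ^ s) dvd a"
    using gen_gcd_powerE[OF assms] by metis
  show ?thesis using sum_klee_phi_divisors[OF g(1) assms(2)] by (simp only: g(2,3))
qed

theorem theorem3p4:
  fixes n s :: nat
  assumes "n > 0" and "s > 0"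
  shows "(\<Sum>a | a \<in> {1..n ^ s} \<and> gen_gcd s (int a) (int (n ^ s)) = 1.
            gen_gcd s (int a - 1) (int (n ^ s)))
         = klee_phi s (n ^ s) * tau_s s (n ^ s)"
proof -
  let ?N = "int (n ^ s)" and ?U = "klee_residues s (n ^ s)"
  let ?h = "\<lambda>a. if gen_gcd s a ?N = 1 then gen_gcd s (a - 1) ?N else 0"
  have "(\<Sum>a | a \<in> {1..n ^ s} \<and> gen_gcd s (int a) ?N = 1. gen_gcd s (int a - 1) ?N)
      = (\<Sum>a\<in>{1..n ^ s}. ?h (int a))"
    by (intro sum.inter_filter) simp
  also have "\<dots> = (\<Sum>a\<in>{0..<?N}. ?h a)"
    \<comment> \<open>The summand depends only on \<open>a\<close> modulo \<open>?N\<close>, so the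
      endpoint \<open>?N\<close> may be replaced by 0.\<close>
    using gen_gcd_cong[of 0 ?N ?N s] gen_gcd_cong[of "0 - 1" "?N - 1" ?N s]
    by (intro sum_int_residues) (simp add: cong_iff_dvd_diff)
  also have "\<dots> = (\<Sum>a\<in>?U. gen_gcd s (a - 1) ?N)"
    unfolding klee_residues_def by (intro sum.inter_filter [symmetric]) simp
  also have "\<dots> = (\<Sum>a\<in>?U. \<Sum>d | d \<in> {d. d dvd n} \<and> int (d ^ s) dvd a - 1. klee_phi s (d ^ s))"
    by (simp only: gen_gcd_eq_sum_klee_phi[OF assms] mem_Collect_eq)
  also have "\<dots> = (\<Sum>d | d dvd n. \<Sum>a | a \<in> ?U \<and> int (d ^ s) dvd a - 1. klee_phi s (d ^ s))"
    using assms by (intro sum.swap_restrict) auto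
  also have "\<dots> = (\<Sum>d | d dvd n. klee_phi s (n ^ s))"
  proof (rule sum.cong)
    fix d assume "d \<in> {d. d dvd n}"
    hence d: "d dvd n" by simp
    have "gen_gcd s 1 ?N = 1"
      unfolding gen_gcd_eq_1_iff[OF assms] using assms by (auto simp: prime_nat_iff)
    \<comment> \<open>The \<open>mod\<close> matters for \<open>d = 1\<close>, where the
      representative of 1 is 0.\<close>
    hence "1 mod int (d ^ s) \<in> klee_residues s (d ^ s)"
      using mod_in_klee_residues[OF assms d] by blast
    from klee_phi_mult_card_fibre[OF assms d this]
    show "(\<Sum>a | a \<in> ?U \<and> int (d ^ s) dvd a - 1. klee_phi s (d ^ s)) = klee_phi s (n ^ s)"
      by (simp add: mod_eq_dvd_iff mult.commute)
  qed simp
  also have "\<dots> = klee_phi s (n ^ s) * tau_s s (n ^ s)"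
  proof -
    \<comment> \<open>For \<open>s > 0\<close>, \<open>d ^ s dvd n ^ s\<close> is equivalent to
      \<open>d dvd n\<close>.\<close>
    have "{d. d > 0 \<and> d ^ s dvd n ^ s} = {d. d dvd n}"
      using assms by (auto intro: Nat.gr0I)
    thus ?thesis unfolding tau_s_def by simp
  qed
  finally show ?thesis .
qed

end
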